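(* Let $G$ be a connected graph of order $n$ and maximum degree $\Delta$. (1) If $n-2\le \Delta\le n-1$, then $\gamma_p(G)=1$. (2) If $n-4\le \Delta\le n-3$, then $1\le \gamma_p(G)\le 2$.
   Context: All graphs are finite, simple and undirected. $N[v]$ denotes the closed neighborhood of $v$ and $N[S]=\bigcup_{v\in S}N[v]$. For $U\subseteq V(G)$, the closure $cl(U)$ is the set obtained from $U$ by repeatedly applying, until no more changes are possible, the rule: if a vertex $u$ is in the current set and exactly one neighbor $w$ of $u$ is not in it, then add $w$. A set $S\subseteq V(G)$ is a power dominating set of $G$ if $cl(N[S])=V(G)$, and the power domination number $\gamma_p(G)$ is the minimum cardinality of a power dominating set. *)

theory Defs
  imports "Graph_Theory.Digraph_Component"
begin

(* Finite simple undirected graphs are the library's "graph": finite, loop-free, symmetric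
   digraphs without parallel arcs. An undirected edge is a pair of opposite arcs, so the degree
   of a vertex is its out_degree (= in_degree). *)

definition max_degree :: "('a, 'b) pre_digraph \<Rightarrow> nat" where
  "max_degree G = Max (out_degree G ` verts G)"

definition neighborhood :: "('a, 'b) pre_digraph \<Rightarrow> 'a \<Rightarrow> 'a set" where
  "neighborhood G v = {w. v \<rightarrow>\<^bsub>G\<^esub> w}"

definition closed_neighborhood :: "('a, 'b) pre_digraph \<Rightarrow> 'a \<Rightarrow> 'a set" where
  "closed_neighborhood G v = insert v (neighborhood G v)"

definition closed_neighborhood_set :: "('a, 'b) pre_digraph \<Rightarrow> 'a set \<Rightarrow> 'a set" where
  "closed_neighborhood_set G S = (\<Union>v\<in>S. closed_neighborhood G v)"

definition force_step :: "('a, 'b) pre_digraph \<Rightarrow> 'a set \<Rightarrow> 'a set \<Rightarrow> bool" where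
  "force_step G A B \<longleftrightarrow> (\<exists>u\<in>A. \<exists>w. neighborhood G u - A = {w} \<and> B = insert w A)"

(* The outcome of applying the rule until no step changes the set. It does not depend on the
   order of the steps, and it exists because G is finite: see ex1_forcing_closure. *)
definition forcing_closure :: "('a, 'b) pre_digraph \<Rightarrow> 'a set \<Rightarrow> 'a set" where
  "forcing_closure G U = (THE C. (force_step G)\<^sup>*\<^sup>* U C \<and> (\<nexists>D. force_step G C D))"

definition power_dominating :: "('a, 'b) pre_digraph \<Rightarrow> 'a set \<Rightarrow> bool" where
  "power_dominating G S \<longleftrightarrow>
     S \<subseteq> verts G \<and> forcing_closure G (closed_neighborhood_set G S) = verts G"

definition power_domination_number :: "('a, 'b) pre_digraph \<Rightarrow> nat" where
  "power_domination_number G = Min (card ` {S. power_dominating G S})"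

lemma force_steps_subset_terminal:
  assumes "(force_step G)\<^sup>*\<^sup>* U A" "U \<subseteq> C" "\<nexists>D. force_step G C D"
  shows "A \<subseteq> C"
  using assms(1)
proof induction
  case base
  show ?case by fact
next
  case (step A B)
  then obtain u w where uw: "u \<in> A" "neighborhood G u - A = {w}" "B = insert w A"
    by (auto simp: force_step_def)
  have "w \<in> C"
  proof (rule ccontr)
    assume "w \<notin> C"
    with uw step.IH have "u \<in> C" "neighborhood G u - C = {w}" by auto
    then have "force_step G C (insert w C)" unfolding force_step_def by blast
    with assms(3) show False by blast
  qed
  with uw step.IH show ?case by simp
qed

lemma force_steps_mono: "(force_step G)\<^sup>*\<^sup>* U A \<Longrightarrow> U \<subseteq> A"
  by (induction rule: rtranclp_induct) (auto simp: force_step_def)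

lemma (in graph) ex1_forcing_closure:
  "\<exists>!C. (force_step G)\<^sup>*\<^sup>* U C \<and> (\<nexists>D. force_step G C D)"
proof (rule ex_ex1I)
  show "\<exists>C. (force_step G)\<^sup>*\<^sup>* U C \<and> (\<nexists>D. force_step G C D)"
  proof (induction "card (verts G - U)" arbitrary: U rule: less_induct)
    case less
    show ?case
    proof (cases "\<exists>D. force_step G U D")
      case True
      then obtain u w where uw: "u \<in> U" "neighborhood G u - U = {w}"
        and st: "force_step G U (insert w U)"
        by (auto simp: force_step_def)
      from uw have "w \<notin> U" "u \<rightarrow> w"
        by (auto simp: neighborhood_def)
      then have "w \<in> verts G - U" by auto
      then have "card (verts G - insert w U) < card (verts G - U)"
        by (intro psubset_card_mono) auto
      from less[OF this] st show ?thesis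
        by (meson converse_rtranclp_into_rtranclp)
    qed auto
  qed
next
  fix C C'
  assume "(force_step G)\<^sup>*\<^sup>* U C \<and> (\<nexists>D. force_step G C D)"
    and "(force_step G)\<^sup>*\<^sup>* U C' \<and> (\<nexists>D. force_step G C' D)"
  then show "C = C'"
    by (metis force_steps_mono force_steps_subset_terminal subset_antisym)
qed

end

theory Submission
  imports Defs
begin

text \<open>
  Choose a vertex \<open>v\<close> of maximum degree and let \<open>R\<close> be the set of the \<open>n - 1 - \<Delta>\<close> vertices outside
  \<open>N[v]\<close>; in the two parts of the theorem it has at most one and at most three elements,
  respectively. The key observation (\<open>power_dominating_if_unique_unobserved_neighbor\<close>) is that in a
  connected graph a nonempty set \<open>S\<close> is power dominating as soon as no vertex has two neighbors
  outside \<open>N[S]\<close>: forcing can only stop at a proper subset of the vertices if every edge that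
  leaves the subset comes from a vertex with at least two neighbors outside it.

  If \<open>R\<close> has at most one element, this applies to \<open>{v}\<close>. If \<open>R\<close> has at most three elements and it
  does not apply to \<open>{v}\<close>, then some vertex \<open>x\<close> has two neighbors in \<open>R\<close>. Hence \<open>N[{v, x}]\<close> misses
  at most one vertex, and the observation applies to \<open>{v, x}\<close>. The vertex \<open>x\<close> may lie in \<open>N[v]\<close> or
  in \<open>R\<close>, so that edges inside \<open>R\<close> do not have to be treated separately.
\<close>

lemma (in digraph) card_closed_neighborhood:
  "card (closed_neighborhood G v) = Suc (out_degree G v)"
proof -
  have img: "neighborhood G v = head G ` out_arcs G v"
    by (auto simp: neighborhood_def arcs_ends_conv)
  have "inj_on (head G) (out_arcs G v)"
    by (rule inj_onI) (auto intro: no_multi_arcs simp: arc_to_ends_def)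
  then have "card (neighborhood G v) = out_degree G v"
    unfolding img out_degree_def by (rule card_image)
  moreover have "finite (neighborhood G v)"
    unfolding img by auto
  moreover have "v \<notin> neighborhood G v"
    by (auto simp: neighborhood_def dest: adj_not_same)
  ultimately show ?thesis
    by (simp add: closed_neighborhood_def)
qed

lemma (in wf_digraph) closed_neighborhood_set_subset_verts:
  "S \<subseteq> verts G \<Longrightarrow> closed_neighborhood_set G S \<subseteq> verts G"
  by (auto simp: closed_neighborhood_set_def closed_neighborhood_def neighborhood_def adj_in_verts)

lemma (in sym_digraph) connected_imp_boundary_edge:
  assumes "connected G" "U \<subset> verts G" "U \<noteq> {}"
  obtains u w where "u \<in> U" "w \<notin> U" "u \<rightarrow> w"
proof -
  from assms obtain a b where ab: "a \<in> U" "b \<in> verts G" "b \<notin> U" "a \<in> verts G"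
    by blast
  have "strongly_connected G"
    using assms(1) sym_arcs by (intro symmetric_connected_imp_strongly_connected)
  with ab have "a \<rightarrow>\<^sup>* b"
    by (auto simp: strongly_connected_def)
  have "\<exists>u\<in>U. \<exists>w. w \<notin> U \<and> u \<rightarrow> w"
  proof (rule ccontr)
    assume closed: "\<not> ?thesis"
    from \<open>a \<rightarrow>\<^sup>* b\<close> have "b \<in> U"
      by (induction rule: reachable_induct) (use ab closed in blast)+
    with ab show False by blast
  qed
  with that show thesis by blast
qed

lemma (in graph) forcing_closure_steps:
  "(force_step G)\<^sup>*\<^sup>* U (forcing_closure G U)"
  and forcing_closure_terminal: "\<nexists>D. force_step G (forcing_closure G U) D"
  using theI'[OF ex1_forcing_closure[of U]] by (simp_all add: forcing_closure_def)

lemma (in graph) forcing_closure_subset_verts: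
  assumes "U \<subseteq> verts G"
  shows "forcing_closure G U \<subseteq> verts G"
proof (rule force_steps_subset_terminal[OF forcing_closure_steps assms])
  show "\<nexists>D. force_step G (verts G) D"
    by (auto simp: force_step_def neighborhood_def dest!: equalityD2 adj_in_verts(2))
qed

text \<open>
  If the closure \<open>C\<close> of \<open>N[S]\<close> missed a vertex, connectedness would give an edge \<open>u \<rightarrow> w\<close> that leaves
  \<open>C\<close>. By assumption \<open>w\<close> is the only neighbor of \<open>u\<close> outside \<open>N[S]\<close>, hence the only one outside the
  larger set \<open>C\<close>, and so \<open>u\<close> could still force \<open>w\<close>.
\<close>
lemma (in graph) power_dominating_if_unique_unobserved_neighbor:
  assumes "connected G" "S \<subseteq> verts G" "S \<noteq> {}"
    and unique: "\<And>u w w'. \<lbrakk>u \<rightarrow> w; u \<rightarrow> w'; w \<notin> closed_neighborhood_set G S;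
      w' \<notin> closed_neighborhood_set G S\<rbrakk> \<Longrightarrow> w = w'"
  shows "power_dominating G S"
proof -
  let ?N = "closed_neighborhood_set G S"
  let ?C = "forcing_closure G ?N"
  have N_C: "?N \<subseteq> ?C"
    by (rule force_steps_mono[OF forcing_closure_steps])
  have C_verts: "?C \<subseteq> verts G"
    by (intro forcing_closure_subset_verts closed_neighborhood_set_subset_verts assms(2))
  have "?N \<noteq> {}"
    using assms(3) by (auto simp: closed_neighborhood_set_def closed_neighborhood_def)
  have "?C = verts G"
  proof (rule ccontr)
    assume "?C \<noteq> verts G"
    with C_verts N_C \<open>?N \<noteq> {}\<close> have "?C \<subset> verts G" "?C \<noteq> {}"
      by auto
    with assms(1) obtain u w where uw: "u \<in> ?C" "w \<notin> ?C" "u \<rightarrow> w"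
      by (rule connected_imp_boundary_edge)
    have "neighborhood G u - ?C = {w}"
      using uw N_C unique[of u _ w] by (auto simp: neighborhood_def)
    with uw have "force_step G ?C (insert w ?C)"
      by (auto simp: force_step_def)
    with forcing_closure_terminal show False by blast
  qed
  with assms(2) show ?thesis
    by (simp add: power_dominating_def)
qed

lemma (in graph) power_dominating_if_card_unobserved_le_1:
  assumes "connected G" "S \<subseteq> verts G" "S \<noteq> {}"
    and "card (verts G - closed_neighborhood_set G S) \<le> 1"
  shows "power_dominating G S"
proof -
  have "w = w'" if "w \<in> verts G - closed_neighborhood_set G S"
    "w' \<in> verts G - closed_neighborhood_set G S" for w w'
    using assms(4) that by (simp add: card_le_Suc0_iff_eq)
  then show ?thesis
    using assms(1-3)
    by (intro power_dominating_if_unique_unobserved_neighbor) (auto simp: adj_in_verts)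
qed

text \<open>
  A vertex \<open>v\<close> for which \<open>{v}\<close> is not power dominating is supplemented by a vertex with two
  neighbors outside \<open>N[v]\<close>, which leaves at most one vertex unobserved.
\<close>
lemma (in graph) ex_power_dominating_card_le_2:
  assumes "connected G" "v \<in> verts G"
    and few: "card (verts G - closed_neighborhood G v) \<le> 3"
  obtains S where "power_dominating G S" "card S \<le> 2"
proof (cases "power_dominating G {v}")
  case True
  then show thesis by (rule that) simp
next
  case False
  let ?R = "verts G - closed_neighborhood G v"
  from False assms(1,2) obtain x a b where x: "x \<rightarrow> a" "x \<rightarrow> b" "a \<noteq> b" and ab: "a \<in> ?R" "b \<in> ?R"
    using power_dominating_if_unique_unobserved_neighbor[of "{v}"]
    by (fastforce simp: closed_neighborhood_set_def adj_in_verts)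
  have "verts G - closed_neighborhood_set G {v, x} \<subseteq> ?R - {a, b}"
    using x by (auto simp: closed_neighborhood_set_def closed_neighborhood_def neighborhood_def)
  then have "card (verts G - closed_neighborhood_set G {v, x}) \<le> card (?R - {a, b})"
    by (intro card_mono) auto
  also have "\<dots> = card ?R - 2"
    using ab x(3) by (subst card_Diff_subset) auto
  also have "\<dots> \<le> 1"
    using few by simp
  finally have "power_dominating G {v, x}"
    using assms(1,2) x(1)
    by (intro power_dominating_if_card_unobserved_le_1) (auto simp: adj_in_verts)
  then show thesis
    by (rule that) (simp add: card_insert_if)
qed

lemma (in graph) not_power_dominating_empty:
  assumes "verts G \<noteq> {}"
  shows "\<not> power_dominating G {}"
proof -
  have "\<nexists>D. force_step G {} D"
    by (simp add: force_step_def)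
  then have "forcing_closure G {} \<subseteq> {}"
    by (intro force_steps_subset_terminal[OF forcing_closure_steps]) auto
  with assms show ?thesis
    by (simp add: power_dominating_def closed_neighborhood_set_def)
qed

lemma (in graph) finite_power_dominating: "finite {S. power_dominating G S}"
  by (rule finite_subset[of _ "Pow (verts G)"]) (auto simp: power_dominating_def)

lemma (in graph) power_domination_number_le:
  "power_dominating G S \<Longrightarrow> power_domination_number G \<le> card S"
  unfolding power_domination_number_def
  by (intro Min_le finite_imageI finite_power_dominating) simp

lemma (in graph) power_domination_number_ge_1:
  assumes "verts G \<noteq> {}" "power_dominating G S"
  shows "1 \<le> power_domination_number G"
proof -
  \<comment> \<open>The minimum of an empty set is unspecified, hence the witness \<open>S\<close>.\<close>
  have "1 \<le> card T" if "power_dominating G T" for T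
  proof -
    have "finite T"
      using that by (auto simp: power_dominating_def intro: finite_subset)
    moreover have "T \<noteq> {}"
      using that not_power_dominating_empty[OF assms(1)] by auto
    ultimately show ?thesis
      by (simp add: Suc_le_eq card_gt_0_iff)
  qed
  then show ?thesis
    unfolding power_domination_number_def
    using assms(2) finite_power_dominating by (subst Min_ge_iff) auto
qed

lemma (in fin_digraph) ex_max_degree_vertex:
  assumes "verts G \<noteq> {}"
  obtains v where "v \<in> verts G" "out_degree G v = max_degree G"
proof -
  have "max_degree G \<in> out_degree G ` verts G"
    unfolding max_degree_def using assms by (intro Max_in) auto
  with that show thesis by auto
qed

theorem proposition13:
  fixes G :: "('a, 'b) pre_digraph" and n \<Delta> :: nat
  assumes "graph G" and "connected G"
    and "card (verts G) = n" and "max_degree G = \<Delta>"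
  shows "(int n - 2 \<le> int \<Delta> \<and> int \<Delta> \<le> int n - 1 \<longrightarrow> power_domination_number G = 1) \<and>
         (int n - 4 \<le> int \<Delta> \<and> int \<Delta> \<le> int n - 3 \<longrightarrow>
            1 \<le> power_domination_number G \<and> power_domination_number G \<le> 2)"
proof -
  interpret graph G by fact
  have ne: "verts G \<noteq> {}"
    using assms(2) by (auto simp: connected_def strongly_connected_def)
  then obtain v where v: "v \<in> verts G" "out_degree G v = \<Delta>"
    using assms(4) ex_max_degree_vertex by auto
  let ?R = "verts G - closed_neighborhood G v"
  have single: "closed_neighborhood_set G {v} = closed_neighborhood G v"
    by (simp add: closed_neighborhood_set_def)
  have sub: "closed_neighborhood G v \<subseteq> verts G"
    using closed_neighborhood_set_subset_verts[of "{v}"] v(1) single by simp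
  have card_R: "card ?R = n - Suc \<Delta>"
    using assms(3) v(2) finite_subset[OF sub] sub
    by (simp add: card_Diff_subset card_closed_neighborhood)
  show ?thesis
  proof (intro conjI impI)
    assume "int n - 2 \<le> int \<Delta> \<and> int \<Delta> \<le> int n - 1"
    then have "card ?R \<le> 1"
      using card_R by linarith
    then have "power_dominating G {v}"
      using assms(2) v(1) single by (intro power_dominating_if_card_unobserved_le_1) auto
    then show "power_domination_number G = 1"
      using power_domination_number_le power_domination_number_ge_1[OF ne]
      by (fastforce intro: antisym)
  next
    assume "int n - 4 \<le> int \<Delta> \<and> int \<Delta> \<le> int n - 3"
    then have "card ?R \<le> 3"
      using card_R by linarith
    then obtain S where S: "power_dominating G S" "card S \<le> 2"
      using ex_power_dominating_card_le_2[OF assms(2) v(1)] by blast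
    show "1 \<le> power_domination_number G"
      by (rule power_domination_number_ge_1[OF ne S(1)])
    show "power_domination_number G \<le> 2"
      using power_domination_number_le[OF S(1)] S(2) by simp
  qed
qed

end
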